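(* Fix the number of packet processing stages $T\in\{1,2,\dots\}$, and fix $\beta>0$, $d\ge 0$ and the projection level $\varrho\in(0,1/2]$. For a positive integer $M$, $N=TM$, $p\in(0,1)$ and an arbitrary $\hat D>0$, let $\hat{\mathrm L}^{(3)}_N(\beta,p,d)$ be the normalized regret of Algorithm 3 (defined in the context) run with packet size $M$, variance parameter $\hat D$, $p_1=p+d(\hat D/N)^{1/2}$, $p_2=p-d(\hat D/N)^{1/2}$ and $\beta_t=\beta(\hat D M(t+0.5))^{1/2}$. Then $\hat{\mathrm L}^{(3)}_N(\beta,p,d)$ does not depend on $N$, $M$, $p$, $\hat D$; that is, there is a number $\Lambda=\Lambda(T,\beta,\varrho,d)$ such that $\hat{\mathrm L}^{(3)}_N(\beta,p,d)=\Lambda$ for all positive integers $M$ (with $N=TM$), all $p\in(0,1)$ and all $\hat D>0$.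
   Context: Gibbs distribution: for $\beta'>0$ and $\overline\zeta=(\zeta^{(1)},\zeta^{(2)})\in\mathbb R^2$, $$\overline G_{\beta'}(\overline\zeta)=\frac{1}{e^{-\zeta^{(1)}/\beta'}+e^{-\zeta^{(2)}/\beta'}}\left(e^{-\zeta^{(1)}/\beta'},\,e^{-\zeta^{(2)}/\beta'}\right).$$ Projection operator: for a probability vector $\overline p'=(p'^{(1)},p'^{(2)})$, $\mathcal P_\varrho(\overline p')=\overline p'$ if $p'^{(1)}\ge\varrho$ and $p'^{(2)}\ge\varrho$; $\mathcal P_\varrho(\overline p')=(\varrho,1-\varrho)$ if $p'^{(1)}<\varrho$; $\mathcal P_\varrho(\overline p')=(1-\varrho,\varrho)$ if $p'^{(2)}<\varrho$. Algorithm 3 (parallel mirror descent algorithm with normally distributed incomes and continuous durations). The parameters are $T$, $M$, $N=TM$, $p_1,p_2$, $q_\ell=1-p_\ell$ ($\ell=1,2$), $\hat D>0$, $\varrho$ and the sequence $(\beta_t)_{t=1}^{T}$. Let $Z_t^{(\ell)}$, $\ell=1,2$, $t=1,\dots,T$, be independent standard normal random variables. Start with $\overline p_0=(p_0^{(1)},p_0^{(2)})=(1/2,1/2)$ and $\overline\zeta_0=(0,0)$. For $t=1,\dots,T$: 1. Put $M_t^{(\ell)}=p_{t-1}^{(\ell)}M$, $\ell=1,2$ (not necessarily integers). 2. Apply the $\ell$-th action for duration $M_t^{(\ell)}$ and observe $\eta_t^{(\ell)}=q_\ell M_t^{(\ell)}+(\hat D M_t^{(\ell)})^{1/2}Z_t^{(\ell)}$;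 that is, given the past, $\eta_t^{(\ell)}$ is normal with mean $q_\ell M_t^{(\ell)}$ and variance $\hat D M_t^{(\ell)}$, with fresh independent noise. 3. Compute $\overline u_t=\left(\eta_t^{(1)}/p_{t-1}^{(1)},\ \eta_t^{(2)}/p_{t-1}^{(2)}\right)$. 4. Update $\overline\zeta_t=\overline\zeta_{t-1}+\overline u_t$, $\overline p'_t=\overline G_{\beta_t}(\overline\zeta_t)$, $\overline p_t=\mathcal P_\varrho(\overline p'_t)$. Regret: the quantities $\eta_t^{(\ell)}$ model numbers of failures, so the expected income from applying action $\ell$ for duration $M_t^{(\ell)}$ is $p_\ell M_t^{(\ell)}$. The regret is the maximal possible expected income minus the expected income of the algorithm: $$L_N=N\max(p_1,p_2)-\sum_{t=1}^{T}\sum_{\ell=1}^{2}p_\ell\,M\,\mathbb E\left(p_{t-1}^{(\ell)}\right).$$ The normalized regret (normalized loss function) is $\hat{\mathrm L}^{(3)}_N(\beta,p,d)=(\hat D N)^{-1/2}L_N$. *)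

theory Defs
  imports "HOL-Probability.Probability"
begin

text \<open>The two actions are the two elements \<open>1\<close> and \<open>2\<close> of the index type \<open>2\<close>, so that all
  two-component vectors of the algorithm have type \<open>real ^ 2\<close>.\<close>

definition gibbs :: "real \<Rightarrow> real ^ 2 \<Rightarrow> real ^ 2" where
  "gibbs b \<zeta> = (\<chi> l. exp (- \<zeta> $ l / b) / (exp (- \<zeta> $ 1 / b) + exp (- \<zeta> $ 2 / b)))"

text \<open>For a probability vector and \<open>\<rho> \<le> 1/2\<close> at most one component can lie below \<open>\<rho>\<close>,
  so the order of the tests is immaterial.\<close>

definition proj :: "real \<Rightarrow> real ^ 2 \<Rightarrow> real ^ 2" where
  "proj \<rho> p' =
     (if p' $ 1 \<ge> \<rho> \<and> p' $ 2 \<ge> \<rho> then p'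
      else if p' $ 1 < \<rho> then vector [\<rho>, 1 - \<rho>]
      else vector [1 - \<rho>, \<rho>])"

text \<open>One run of the algorithm for a fixed realization \<open>z t l\<close> of the noise, with success
  parameters \<open>pr\<close>, packet size \<open>M\<close>, variance parameter \<open>D\<close> and schedule \<open>bs\<close>.
  The value at \<open>t\<close> is the pair of \<open>\<zeta>\<^sub>t\<close> and \<open>p\<^sub>t\<close>.\<close>

primrec pmd_state ::
  "(nat \<Rightarrow> real) \<Rightarrow> real \<Rightarrow> real ^ 2 \<Rightarrow> nat \<Rightarrow> real \<Rightarrow> (nat \<Rightarrow> 2 \<Rightarrow> real) \<Rightarrow> nat
    \<Rightarrow> (real ^ 2) \<times> (real ^ 2)" where
  "pmd_state bs \<rho> pr M D z 0 = (0, vector [1/2, 1/2])"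
| "pmd_state bs \<rho> pr M D z (Suc t) =
    (let (\<zeta>, p) = pmd_state bs \<rho> pr M D z t;
         m = (\<chi> l. p $ l * real M);
         \<eta> = (\<chi> l. (1 - pr $ l) * m $ l + sqrt (D * m $ l) * z (Suc t) l);
         u = (\<chi> l. \<eta> $ l / p $ l);
         \<zeta>' = \<zeta> + u
     in (\<zeta>', proj \<rho> (gibbs (bs (Suc t)) \<zeta>')))"

definition pmd_prob ::
  "(nat \<Rightarrow> real) \<Rightarrow> real \<Rightarrow> real ^ 2 \<Rightarrow> nat \<Rightarrow> real \<Rightarrow> (nat \<Rightarrow> 2 \<Rightarrow> real) \<Rightarrow> nat \<Rightarrow> real ^ 2" where
  "pmd_prob bs \<rho> pr M D z t = snd (pmd_state bs \<rho> pr M D z t)"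

definition std_normal_noise :: "nat \<Rightarrow> 'a measure \<Rightarrow> (nat \<Rightarrow> 2 \<Rightarrow> 'a \<Rightarrow> real) \<Rightarrow> bool" where
  "std_normal_noise T \<Omega> Z \<longleftrightarrow>
     prob_space \<Omega> \<and>
     prob_space.indep_vars \<Omega> (\<lambda>_. borel) (\<lambda>(t, l). Z t l) ({1..T} \<times> UNIV) \<and>
     (\<forall>t\<in>{1..T}. \<forall>l. distributed \<Omega> lborel (Z t l) std_normal_density)"

definition regret ::
  "nat \<Rightarrow> (nat \<Rightarrow> real) \<Rightarrow> real \<Rightarrow> real ^ 2 \<Rightarrow> nat \<Rightarrow> real
    \<Rightarrow> 'a measure \<Rightarrow> (nat \<Rightarrow> 2 \<Rightarrow> 'a \<Rightarrow> real) \<Rightarrow> real" where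
  "regret T bs \<rho> pr M D \<Omega> Z =
     real (T * M) * max (pr $ 1) (pr $ 2)
     - (\<Sum>t = 1..T. \<Sum>l\<in>UNIV. pr $ l * real M *
          (\<integral>\<omega>. pmd_prob bs \<rho> pr M D (\<lambda>s k. Z s k \<omega>) (t - 1) $ l \<partial>\<Omega>))"

definition normalized_regret ::
  "nat \<Rightarrow> real \<Rightarrow> real \<Rightarrow> real \<Rightarrow> nat \<Rightarrow> real \<Rightarrow> real
    \<Rightarrow> 'a measure \<Rightarrow> (nat \<Rightarrow> 2 \<Rightarrow> 'a \<Rightarrow> real) \<Rightarrow> real" where
  "normalized_regret T \<beta> \<rho> d M p D \<Omega> Z =
     (let N = real (T * M);
          pr = vector [p + d * sqrt (D / N), p - d * sqrt (D / N)];
          bs = (\<lambda>t. \<beta> * sqrt (D * real M * (real t + 1/2)))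
      in regret T bs \<rho> pr M D \<Omega> Z / sqrt (D * N))"

text \<open>A concrete probability space carrying the noise, the coordinate functions being the
  random variables. It ties a quantity asserted to be common to all probability spaces over a
  type \<open>'a\<close> to one that does not depend on \<open>'a\<close>.\<close>

definition canonical_space :: "nat \<Rightarrow> (nat \<times> 2 \<Rightarrow> real) measure" where
  "canonical_space T = (\<Pi>\<^sub>M i\<in>{1..T} \<times> UNIV. density lborel std_normal_density)"

definition canonical_noise :: "nat \<Rightarrow> 2 \<Rightarrow> (nat \<times> 2 \<Rightarrow> real) \<Rightarrow> real" where
  "canonical_noise t l \<omega> = \<omega> (t, l)"

lemma std_normal_noise_canonical: "std_normal_noise T (canonical_space T) canonical_noise"
proof -
  let ?I = "{1..T} \<times> (UNIV :: 2 set)"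
  let ?N = "density lborel (\<lambda>x. ennreal (std_normal_density x))"
  let ?P = "PiM ?I (\<lambda>_. ?N)"
  have N: "prob_space ?N" by (rule prob_space_normal_density) simp
  interpret P: prob_space ?P by (rule prob_space_PiM) (rule N)
  have eq: "(\<lambda>(t, l). canonical_noise t l) = (\<lambda>i \<omega>. \<omega> i)"
    by (auto simp: canonical_noise_def fun_eq_iff)
  have comp: "distr ?P ?N (\<lambda>\<omega>. \<omega> i) = ?N" if "i \<in> ?I" for i
    by (rule distr_PiM_component[of ?I "\<lambda>_. ?N" i]) (use N that in auto)
  have ind: "P.indep_vars (\<lambda>_. borel) (\<lambda>i \<omega>. \<omega> i) ?I"
  proof (cases "?I = {}")
    case True
    show ?thesis unfolding P.indep_vars_def P.indep_sets_def using True by auto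
  next
    case False
    have rv: "(\<lambda>\<omega>. \<omega> i) \<in> measurable ?P borel" if "i \<in> ?I" for i
      using measurable_component_singleton[OF that, of "\<lambda>_. ?N"] by simp
    have "distr ?P (PiM ?I (\<lambda>_. borel)) (\<lambda>\<omega>. \<lambda>i\<in>?I. \<omega> i) = distr ?P ?P (\<lambda>\<omega>. \<omega>)"
      by (rule distr_cong) (auto simp: space_PiM intro!: sets_PiM_cong)
    also have "\<dots> = PiM ?I (\<lambda>i. distr ?P borel (\<lambda>\<omega>. \<omega> i))"
      unfolding distr_id by (rule PiM_cong[OF refl], subst comp[symmetric], assumption)
        (auto intro!: distr_cong)
    finally show ?thesis
      using rv by (subst P.indep_vars_iff_distr_eq_PiM'[OF False]) auto
  qed
  have "distributed ?P lborel (\<lambda>\<omega>. \<omega> i) std_normal_density" if "i \<in> ?I" for i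
  proof -
    have "(\<lambda>\<omega>. \<omega> i) \<in> measurable ?P ?N" using that by (rule measurable_component_singleton)
    then have "(\<lambda>\<omega>. \<omega> i) \<in> measurable ?P lborel" by simp
    moreover have "distr ?P lborel (\<lambda>\<omega>. \<omega> i) = ?N"
      using comp[OF that] by (subst (2) comp[OF that, symmetric]) (intro distr_cong, auto)
    ultimately show ?thesis unfolding distributed_def by simp
  qed
  then show ?thesis
    unfolding std_normal_noise_def canonical_space_def eq
    using ind P.prob_space_axioms by (auto simp: canonical_noise_def[abs_def])
qed

end

theory Submission
  imports Defs
begin

text \<open>Write \<open>s = sqrt (D * M)\<close>. In one stage the increment of \<open>\<zeta>\<^sup>l\<close> is
  \<open>(1 - p) M + s (\<mp> d / sqrt T + Z\<^sup>l / sqrt p\<^sup>l)\<close>. The first summand is common to both actions, so the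
  Gibbs distribution ignores it, and the factor \<open>s\<close> cancels against the one in \<open>\<beta>\<^sub>t\<close>. Hence for every
  realization of the noise the sequence of probability vectors is that of a reference run with
  \<open>M = D = 1\<close>. Since \<open>p\<^sup>1 + p\<^sup>2 = 1\<close>, the normalized regret is
  \<open>d - (d / T) \<Sum>\<^sub>t E (p\<^sub>t\<^sup>1 - p\<^sub>t\<^sup>2)\<close>.\<close>

lemma gibbs_sum: "gibbs b \<zeta> $ 1 + gibbs b \<zeta> $ 2 = 1"
proof -
  have "exp (- \<zeta> $ 1 / b) + exp (- \<zeta> $ 2 / b) > 0" by (simp add: add_pos_pos)
  then show ?thesis by (simp add: gibbs_def add_divide_distrib[symmetric])
qed

text \<open>The shift \<open>c\<close> puts the same factor \<open>exp (- (c / (s * b)))\<close>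
  into numerator and denominator, and \<open>s\<close> cancels inside each exponent.\<close>

lemma gibbs_affine:
  assumes "s \<noteq> 0"
  shows "gibbs (s * b) (\<chi> l. c + s * \<zeta> $ l) = gibbs b \<zeta>"
proof -
  have e: "exp (- (c + s * x) / (s * b)) = exp (- (c / (s * b))) * exp (- x / b)" for x
    using assms by (simp add: exp_add[symmetric] add_divide_distrib diff_divide_distrib)
  show ?thesis unfolding gibbs_def vec_lambda_beta e distrib_left[symmetric] by simp
qed

lemma proj_sum: "p' $ 1 + p' $ 2 = 1 \<Longrightarrow> proj \<rho> p' $ 1 + proj \<rho> p' $ 2 = 1"
  by (simp add: proj_def)

text \<open>As \<open>1 - \<rho>\<close> is at least \<open>\<rho>\<close>, both replacement vectors
  respect the floor. This keeps the probabilities positive, so dividing by them is genuine.\<close>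

lemma proj_ge: "\<rho> \<le> 1/2 \<Longrightarrow> \<rho> \<le> proj \<rho> p' $ l"
  using exhaust_2[of l] by (auto simp: proj_def)

lemma pmd_prob_Suc:
  "pmd_prob bs \<rho> pr M D z (Suc t) = proj \<rho> (gibbs (bs (Suc t)) (fst (pmd_state bs \<rho> pr M D z (Suc t))))"
  by (simp add: pmd_prob_def Let_def split_beta)

lemma pmd_prob_sum: "pmd_prob bs \<rho> pr M D z t $ 1 + pmd_prob bs \<rho> pr M D z t $ 2 = 1"
proof (cases t)
  case 0
  then show ?thesis by (simp add: pmd_prob_def)
next
  case (Suc t')
  then show ?thesis by (simp only: pmd_prob_Suc proj_sum gibbs_sum)
qed

lemma pmd_prob_ge:
  assumes "\<rho> \<le> 1/2"
  shows "\<rho> \<le> pmd_prob bs \<rho> pr M D z t $ l"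
proof (cases t)
  case 0
  then show ?thesis using assms exhaust_2[of l] by (auto simp: pmd_prob_def)
next
  case (Suc t')
  then show ?thesis by (simp only: pmd_prob_Suc proj_ge[OF assms])
qed

lemma pmd_prob_le_1:
  assumes "0 < \<rho>" "\<rho> \<le> 1/2"
  shows "pmd_prob bs \<rho> pr M D z t $ l \<le> 1"
  using pmd_prob_sum[of bs \<rho> pr M D z t] pmd_prob_ge[OF assms(2), of bs pr M D z t 1]
    pmd_prob_ge[OF assms(2), of bs pr M D z t 2] assms(1) exhaust_2[of l] by auto

lemma fst_pmd_state_Suc:
  "fst (pmd_state bs \<rho> pr M D z (Suc t)) $ l =
     fst (pmd_state bs \<rho> pr M D z t) $ l +
     ((1 - pr $ l) * (pmd_prob bs \<rho> pr M D z t $ l * real M) +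
       sqrt (D * (pmd_prob bs \<rho> pr M D z t $ l * real M)) * z (Suc t) l) /
     pmd_prob bs \<rho> pr M D z t $ l"
  by (simp add: pmd_prob_def Let_def split_beta)

text \<open>The duration is proportional to \<open>x\<close>: dividing by \<open>x\<close> removes
  it from the drift and leaves \<open>sqrt x / x = 1 / sqrt x\<close> in the noise.\<close>

lemma pmd_increment:
  assumes "0 < x" "0 \<le> D"
  shows "(a * (x * real M) + sqrt (D * (x * real M)) * y) / x = a * real M + sqrt (D * real M) * (y / sqrt x)"
proof -
  have "sqrt (D * (x * real M)) / x = sqrt (D * real M) / sqrt x"
    using assms by (simp add: real_sqrt_mult field_simps)
  then show ?thesis using assms
    by (simp add: add_divide_distrib) (metis times_divide_eq_left times_divide_eq_right mult.commute)
qed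

lemma fst_pmd_state_increment:
  assumes "0 < \<rho>" "\<rho> \<le> 1/2" "0 \<le> D"
  shows "fst (pmd_state bs \<rho> pr M D z (Suc t)) $ l =
    fst (pmd_state bs \<rho> pr M D z t) $ l + (1 - pr $ l) * real M +
    sqrt (D * real M) * (z (Suc t) l / sqrt (pmd_prob bs \<rho> pr M D z t $ l))"
proof -
  have "pmd_prob bs \<rho> pr M D z t $ l > 0"
    using pmd_prob_ge[OF assms(2), of bs pr M D z t l] assms(1) by linarith
  then show ?thesis unfolding fst_pmd_state_Suc by (simp only: pmd_increment assms(3) add.assoc)
qed

text \<open>The two claims need a joint induction: equal probabilities give equal noise weights in
  the next increment, and affinely related scores give equal Gibbs vectors. The shift
  \<open>a\<close> must be the same for both actions.\<close>

lemma pmd_scaling: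
  fixes pr pr' :: "real ^ 2"
  assumes "M > 0" "D > 0" "0 < \<rho>" "\<rho> \<le> 1/2"
    and drift: "\<And>l. (1 - pr $ l) * real M = a + sqrt (D * real M) * (1 - pr' $ l)"
  shows "pmd_prob (\<lambda>t. sqrt (D * real M) * bs t) \<rho> pr M D z t = pmd_prob bs \<rho> pr' 1 1 z t \<and>
    (\<forall>l. fst (pmd_state (\<lambda>t. sqrt (D * real M) * bs t) \<rho> pr M D z t) $ l =
       real t * a + sqrt (D * real M) * fst (pmd_state bs \<rho> pr' 1 1 z t) $ l)"
proof (induction t)
  case 0
  show ?case by (simp add: pmd_prob_def)
next
  case (Suc t)
  let ?s = "sqrt (D * real M)"
  let ?A = "pmd_state (\<lambda>t. ?s * bs t) \<rho> pr M D z" and ?B = "pmd_state bs \<rho> pr' 1 1 z"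
  have s: "?s \<noteq> 0" using assms by simp
  \<comment> \<open>Both runs weight the noise by the same probabilities, so \<open>drift\<close>
    supplies one further \<open>a\<close> and the factor \<open>?s\<close> comes out.\<close>
  have step: "fst (?A (Suc t)) $ l = real (Suc t) * a + ?s * fst (?B (Suc t)) $ l" for l
    using Suc assms(2) drift[of l]
    by (simp add: fst_pmd_state_increment[OF assms(3,4)] algebra_simps del: pmd_state.simps)
  then have "fst (?A (Suc t)) = (\<chi> l. real (Suc t) * a + ?s * fst (?B (Suc t)) $ l)"
    by (simp add: vec_eq_iff)
  then have "pmd_prob (\<lambda>t. ?s * bs t) \<rho> pr M D z (Suc t) = pmd_prob bs \<rho> pr' 1 1 z (Suc t)"
    by (simp only: pmd_prob_Suc gibbs_affine[OF s])
  with step show ?case by blast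
qed

text \<open>Stage \<open>t\<close> reads only the noise of stages 1 to \<open>t\<close>, so a
  realization may be restricted to the indices that carry a law.\<close>

lemma pmd_state_cong:
  assumes "\<And>s k. s \<in> {1..t} \<Longrightarrow> z s k = z' s k"
  shows "pmd_state bs \<rho> pr M D z t = pmd_state bs \<rho> pr M D z' t"
  using assms by (induction t) (simp_all add: Let_def split_beta)

lemma measurable_gibbs:
  assumes "\<And>l. (\<lambda>\<omega>. \<zeta> \<omega> $ l) \<in> borel_measurable \<Omega>"
  shows "(\<lambda>\<omega>. gibbs b (\<zeta> \<omega>) $ l) \<in> borel_measurable \<Omega>"
  unfolding gibbs_def using assms by simp

lemma measurable_proj:
  assumes [measurable]: "\<And>l. (\<lambda>\<omega>. p' \<omega> $ l) \<in> borel_measurable \<Omega>"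
  shows "(\<lambda>\<omega>. proj \<rho> (p' \<omega>) $ l) \<in> borel_measurable \<Omega>"
  \<comment> \<open>Measurability is treated by coordinates, so the coordinate is moved into the
    branches of the conditional.\<close>
  unfolding proj_def if_distrib[where f = "\<lambda>v. v $ l"] by measurable

lemma measurable_pmd:
  assumes "\<And>s k. s \<in> {1..t} \<Longrightarrow> Z s k \<in> borel_measurable \<Omega>"
  shows "(\<lambda>\<omega>. pmd_prob bs \<rho> pr M D (\<lambda>s k. Z s k \<omega>) t $ l) \<in> borel_measurable \<Omega> \<and>
    (\<lambda>\<omega>. fst (pmd_state bs \<rho> pr M D (\<lambda>s k. Z s k \<omega>) t) $ l) \<in> borel_measurable \<Omega>"
  using assms
proof (induction t arbitrary: l)
  case 0
  show ?case by (simp add: pmd_prob_def)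
next
  case (Suc t)
  note IH = Suc.IH[OF Suc.prems]
  have [measurable]: "(\<lambda>\<omega>. pmd_prob bs \<rho> pr M D (\<lambda>s k. Z s k \<omega>) t $ k) \<in> borel_measurable \<Omega>"
    "(\<lambda>\<omega>. fst (pmd_state bs \<rho> pr M D (\<lambda>s k. Z s k \<omega>) t) $ k) \<in> borel_measurable \<Omega>"
    "Z (Suc t) k \<in> borel_measurable \<Omega>" for k
    using IH Suc.prems by auto
  have "(\<lambda>\<omega>. fst (pmd_state bs \<rho> pr M D (\<lambda>s k. Z s k \<omega>) (Suc t)) $ k) \<in> borel_measurable \<Omega>" for k
    unfolding fst_pmd_state_Suc by measurable
  then show ?case unfolding pmd_prob_Suc by (auto intro!: measurable_proj measurable_gibbs)
qed

lemma std_normal_noise_measurable: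
  "std_normal_noise T \<Omega> Z \<Longrightarrow> s \<in> {1..T} \<Longrightarrow> Z s k \<in> borel_measurable \<Omega>"
  unfolding std_normal_noise_def by (auto dest!: bspec distributed_measurable)

text \<open>Independence makes the joint law the product of its marginals, all standard normal;
  nothing of \<Omega> survives. \<open>T \<ge> 1\<close> makes the index set nonempty, as the
  product criterion requires.\<close>

lemma std_normal_noise_joint:
  assumes "std_normal_noise T \<Omega> Z" "T \<ge> 1"
  shows "distr \<Omega> (Pi\<^sub>M ({1..T} \<times> UNIV) (\<lambda>_. borel)) (\<lambda>\<omega>. \<lambda>(t, l)\<in>{1..T} \<times> UNIV. Z t l \<omega>) = canonical_space T"
proof -
  let ?I = "{1..T} \<times> (UNIV :: 2 set)"
  interpret prob_space \<Omega> using assms(1) by (simp add: std_normal_noise_def)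
  have rv: "(\<lambda>(t, l). Z t l) i \<in> borel_measurable \<Omega>" if "i \<in> ?I" for i
    using std_normal_noise_measurable[OF assms(1)] that by auto
  have ind: "indep_vars (\<lambda>_. borel) (\<lambda>(t, l). Z t l) ?I"
    using assms(1) by (simp add: std_normal_noise_def)
  have ne: "?I \<noteq> {}" using assms(2) by auto
  have marginal: "distr \<Omega> borel ((\<lambda>(t, l). Z t l) i) = density lborel std_normal_density" if mem: "i \<in> ?I" for i
  proof -
    obtain t l where i: "i = (t, l)" "t \<in> {1..T}" using mem by blast
    then have "distr \<Omega> lborel (Z t l) = density lborel std_normal_density"
      using assms(1) unfolding std_normal_noise_def by (auto dest!: bspec simp: distributed_def)
    \<comment> \<open>\<open>borel\<close> and \<open>lborel\<close> have the same measurable sets,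
      hence the same image measure.\<close>
    moreover have "distr \<Omega> borel (Z t l) = distr \<Omega> lborel (Z t l)" by (rule distr_cong) auto
    ultimately show ?thesis by (simp add: i)
  qed
  have "distr \<Omega> (Pi\<^sub>M ?I (\<lambda>_. borel)) (\<lambda>\<omega>. \<lambda>i\<in>?I. (\<lambda>(t, l). Z t l) i \<omega>) =
      (\<Pi>\<^sub>M i\<in>?I. distr \<Omega> borel ((\<lambda>(t, l). Z t l) i))"
    using ind indep_vars_iff_distr_eq_PiM'[OF ne, of "\<lambda>(t, l). Z t l" "\<lambda>_. borel"] rv by blast
  also have "\<dots> = canonical_space T"
    unfolding canonical_space_def by (intro PiM_cong refl marginal)
  finally show ?thesis by (simp add: split_def)
qed

text \<open>The probability vector is a measurable function of the noise, so its mean depends only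
  on the joint law; this is a change of variables.\<close>

lemma expectation_pmd_prob_canonical:
  assumes "std_normal_noise T \<Omega> Z" "T \<ge> 1" "t \<le> T"
  shows "(\<integral>\<omega>. pmd_prob bs \<rho> pr M D (\<lambda>s k. Z s k \<omega>) t $ l \<partial>\<Omega>) =
    (\<integral>\<omega>. pmd_prob bs \<rho> pr M D (\<lambda>s k. canonical_noise s k \<omega>) t $ l \<partial>canonical_space T)"
proof -
  let ?I = "{1..T} \<times> (UNIV :: 2 set)"
  let ?X = "\<lambda>\<omega>. \<lambda>(t, l)\<in>?I. Z t l \<omega>"
  let ?F = "\<lambda>\<omega>. pmd_prob bs \<rho> pr M D (\<lambda>s k. canonical_noise s k \<omega>) t $ l"
  have X: "?X \<in> measurable \<Omega> (Pi\<^sub>M ?I (\<lambda>_. borel))"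
    using std_normal_noise_measurable[OF assms(1)] by (intro measurable_restrict) auto
  have F: "?F \<in> borel_measurable (Pi\<^sub>M ?I (\<lambda>_. borel))"
    unfolding canonical_noise_def
    by (rule measurable_pmd[where Z = "\<lambda>s k \<omega>. \<omega> (s, k)", THEN conjunct1])
      (use assms(3) in auto)
  have "?F (?X \<omega>) = pmd_prob bs \<rho> pr M D (\<lambda>s k. Z s k \<omega>) t $ l" for \<omega>
    unfolding pmd_prob_def
    by (subst pmd_state_cong[where z' = "\<lambda>s k. Z s k \<omega>"])
      (use assms(3) in \<open>auto simp: canonical_noise_def\<close>)
  then show ?thesis
    unfolding std_normal_noise_joint[OF assms(1,2), symmetric] integral_distr[OF X F]
    by (simp only:)
qed

text \<open>The right-hand side is free of \<open>M\<close>, \<open>p\<close> and \<open>D\<close>.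
  The reference parameters \<open>pr\<close> are centred at 1, so that the reference drifts
  \<open>1 - pr $ l\<close> are just \<open>- d / sqrt T\<close> and
  \<open>d / sqrt T\<close>.\<close>

lemma normalized_regret_eq:
  fixes \<beta> d :: real
  assumes "T \<ge> 1" "d \<ge> 0" "0 < \<rho>" "\<rho> \<le> 1/2" "M > 0" "D > 0" and noise: "std_normal_noise T \<Omega> Z"
  defines "bs \<equiv> (\<lambda>t. \<beta> * sqrt (real t + 1/2))"
    and "pr \<equiv> vector [1 + d / sqrt (real T), 1 - d / sqrt (real T)]"
  shows "normalized_regret T \<beta> \<rho> d M p D \<Omega> Z =
    d - d / real T * (\<Sum>t = 1..T.
      (\<integral>\<omega>. pmd_prob bs \<rho> pr 1 1 (\<lambda>s k. Z s k \<omega>) (t - 1) $ 1 \<partial>\<Omega>) -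
      (\<integral>\<omega>. pmd_prob bs \<rho> pr 1 1 (\<lambda>s k. Z s k \<omega>) (t - 1) $ 2 \<partial>\<Omega>))"
proof -
  interpret prob_space \<Omega> using noise by (simp add: std_normal_noise_def)
  let ?\<epsilon> = "d * sqrt (D / real (T * M))" and ?s = "sqrt (D * real M)"
  let ?pr = "vector [p + ?\<epsilon>, p - ?\<epsilon>] :: real ^ 2"
  let ?P = "\<lambda>t \<omega>. pmd_prob bs \<rho> pr 1 1 (\<lambda>s k. Z s k \<omega>) t"
  let ?E = "\<lambda>t l. \<integral>\<omega>. ?P t \<omega> $ l \<partial>\<Omega>"
  \<comment> \<open>With \<open>N = T * M\<close>, the gap accumulated over one packet is of the
    same order \<open>?s\<close> as the noise.\<close>
  have \<epsilon>: "?\<epsilon> * real M = ?s * (d / sqrt (real T))"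
    using assms(1,5) by (simp add: real_sqrt_mult real_sqrt_divide field_simps)
  have drift: "(1 - ?pr $ l) * real M = (1 - p) * real M + ?s * (1 - pr $ l)" for l
    using \<epsilon> exhaust_2[of l] unfolding pr_def by (auto simp: algebra_simps)
  have sched: "(\<lambda>t. \<beta> * sqrt (D * real M * (real t + 1/2))) = (\<lambda>t. ?s * bs t)"
    by (simp add: bs_def fun_eq_iff real_sqrt_mult)
  have path: "pmd_prob (\<lambda>t. \<beta> * sqrt (D * real M * (real t + 1/2))) \<rho> ?pr M D z t =
      pmd_prob bs \<rho> pr 1 1 z t" for z t
    unfolding sched using pmd_scaling[OF assms(5,6,3,4) drift] by blast
  \<comment> \<open>Linearity of the integral needs integrability, which follows from measurability
    and the bounds 0 and 1.\<close>
  have E_sum: "?E t 2 = 1 - ?E t 1" if "t \<le> T" for t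
  proof -
    have meas: "(\<lambda>\<omega>. ?P t \<omega> $ l) \<in> borel_measurable \<Omega>" for l
      using measurable_pmd[of t Z \<Omega>] std_normal_noise_measurable[OF noise] that by auto
    have "integrable \<Omega> (\<lambda>\<omega>. ?P t \<omega> $ l)" for l
      using meas pmd_prob_le_1[OF assms(3,4)] order_trans[OF less_imp_le[OF assms(3)] pmd_prob_ge[OF assms(4)]]
      by (intro integrable_const_bound[where B = 1]) auto
    moreover have "?P t \<omega> $ 2 = 1 - ?P t \<omega> $ 1" for \<omega>
      using pmd_prob_sum[of bs \<rho> pr 1 1 "\<lambda>s k. Z s k \<omega>" t] by linarith
    ultimately show ?thesis by (simp add: prob_space)
  qed
  have stage: "(\<Sum>l\<in>UNIV. ?pr $ l * real M * ?E (t - 1) l) =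
      real M * p + real M * ?\<epsilon> * (?E (t - 1) 1 - ?E (t - 1) 2)" if "t \<in> {1..T}" for t
  proof -
    have E: "?E (t - 1) 2 = 1 - ?E (t - 1) 1" using that by (intro E_sum) auto
    have "(p + e) * m * x + (p - e) * m * (1 - x) = m * p + m * e * (x - (1 - x))" for e m x :: real
      by (simp add: algebra_simps)
    then show ?thesis by (simp only: sum_2 vector_2 E)
  qed
  have max: "max (?pr $ 1) (?pr $ 2) = p + ?\<epsilon>" using assms(2,6) by simp
  let ?S = "\<Sum>t = 1..T. ?E (t - 1) 1 - ?E (t - 1) 2"
  have "regret T (\<lambda>t. \<beta> * sqrt (D * real M * (real t + 1/2))) \<rho> ?pr M D \<Omega> Z =
      real (T * M) * (p + ?\<epsilon>) - (\<Sum>t = 1..T. real M * p + real M * ?\<epsilon> * (?E (t - 1) 1 - ?E (t - 1) 2))"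
    unfolding regret_def path max by (intro arg_cong2[where f = minus] sum.cong refl stage)
  \<comment> \<open>The terms \<open>real M * p\<close> of the \<open>T\<close> stages cancel
    against \<open>real (T * M) * p\<close>.\<close>
  also have "\<dots> = ?\<epsilon> * real M * (real T - ?S)"
    by (simp only: sum.distrib sum_distrib_left[symmetric]) (simp add: algebra_simps)
  also have "\<dots> = ?s * sqrt (real T) * (d - d / real T * ?S)"
  proof -
    have "?s * (d / sqrt (real T)) = ?s * sqrt (real T) * (d / real T)"
      using assms(1) by (simp add: field_simps)
    moreover have "d / real T * (real T - ?S) = d - d / real T * ?S"
      using assms(1) by (simp add: right_diff_distrib)
    ultimately show ?thesis unfolding \<epsilon> by (simp only: mult.assoc)
  qed
  also have "?s * sqrt (real T) = sqrt (D * real (T * M))"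
    by (simp add: real_sqrt_mult)
  finally show ?thesis
    unfolding normalized_regret_def Let_def using assms(1,5,6) by simp
qed

text \<open>The closed form is applied to both sides, after which only expectations under two noise
  models remain to be compared. Taking \<open>p = 0\<close> on the right is legitimate because the
  closed form holds for every real \<open>p\<close>.\<close>

lemma normalized_regret_canonical:
  assumes "T \<ge> 1" "d \<ge> 0" "0 < \<rho>" "\<rho> \<le> 1/2" "M > 0" "D > 0" "std_normal_noise T \<Omega> Z"
  shows "normalized_regret T \<beta> \<rho> d M p D \<Omega> Z =
    normalized_regret T \<beta> \<rho> d 1 0 1 (canonical_space T) canonical_noise"
  unfolding normalized_regret_eq[OF assms]
    normalized_regret_eq[OF assms(1-4) zero_less_one zero_less_one std_normal_noise_canonical]
  using assms(1,7)
  by (intro arg_cong2[where f = minus] arg_cong2[where f = times] sum.cong refl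
      expectation_pmd_prob_canonical) auto

theorem theorem4:
  fixes T :: nat and \<beta> d \<rho> :: real
  assumes "T \<ge> 1" and "\<beta> > 0" and "d \<ge> 0" and "0 < \<rho>" and "\<rho> \<le> 1/2"
  shows "\<exists>\<Lambda>::real. \<forall>(M::nat) (p::real) (D::real).
           M > 0 \<and> 0 < p \<and> p < 1 \<and> D > 0 \<longrightarrow>
             normalized_regret T \<beta> \<rho> d M p D (canonical_space T) canonical_noise = \<Lambda> \<and>
             (\<forall>(\<Omega>::'a measure) Z. std_normal_noise T \<Omega> Z \<longrightarrow>
                normalized_regret T \<beta> \<rho> d M p D \<Omega> Z = \<Lambda>)"
  \<comment> \<open>The witness lives on the canonical space and so serves every \<Omega> at
    once.\<close>
  by (rule exI[of _ "normalized_regret T \<beta> \<rho> d 1 0 1 (canonical_space T) canonical_noise"])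
    (intro allI impI conjI normalized_regret_canonical std_normal_noise_canonical assms; simp)

end
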